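(* Let $\mathcal{A}$ be a unital C*-algebra and let $\tau$ be a faithful tracial state on $\mathcal{A}$. Then, on the density space $D_\tau(\mathcal{A})$, the topology induced by the C*-norm metric $d_{\mathcal{A}}$ is finer than (i.e. contains) the topology induced by the Bures metric $d_B^\tau$.
   Context: For a unital C*-algebra $\mathcal{A}$, $\mathcal{A}_+$ denotes the set of positive elements, $\|\cdot\|_{\mathcal{A}}$ the C*-norm, and $d_{\mathcal{A}}(x,y)=\|x-y\|_{\mathcal{A}}$ the induced metric (restricted to whichever subset is under consideration). For a faithful trace $\tau$ on $\mathcal{A}$ (a positive linear functional with $\tau(ab)=\tau(ba)$ for all $a,b$, and $\tau(a^*a)=0$ only if $a=0$; a tracial state is one with $\tau(1_{\mathcal{A}})=1$), the density space is $D_\tau(\mathcal{A})=\{a\in\mathcal{A}_+ : \tau(a)=1\}$. The Bures metric on $D_\tau(\mathcal{A})$ is $d_B^\tau(x,y)=\sqrt{1-\tau(|\sqrt{x}\sqrt{y}|)}$, where $\sqrt{\cdot}$ is the positive square root and $|a|=\sqrt{a^*a}$; it is known (Farenick–Rahaman) that $d_B^\tau$ is a metric. "Finer" is meant in the non-strict sense. *)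

theory Defs
  imports "HOL-Analysis.Analysis"
begin

text \<open>
  A unital C*-algebra is the whole carrier of a type.  The sort \<^class>\<open>real_normed_algebra_1\<close>
  contributes a submultiplicative norm with \<open>norm 1 = 1\<close>; this only rules out the zero algebra,
  which carries no state.
\<close>

class unital_cstar_algebra = real_normed_algebra_1 + banach +
  fixes scaleC :: "complex \<Rightarrow> 'a \<Rightarrow> 'a"  (infixr "*\<^sub>C" 75)
    and star :: "'a \<Rightarrow> 'a"
  assumes scaleC_add_right: "c *\<^sub>C (x + y) = c *\<^sub>C x + c *\<^sub>C y"
    and scaleC_add_left: "(c + d) *\<^sub>C x = c *\<^sub>C x + d *\<^sub>C x"
    and scaleC_scaleC: "c *\<^sub>C (d *\<^sub>C x) = (c * d) *\<^sub>C x"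
    and scaleC_of_real: "complex_of_real r *\<^sub>C x = r *\<^sub>R x"
    and scaleC_mult_left: "(c *\<^sub>C x) * y = c *\<^sub>C (x * y)"
    and scaleC_mult_right: "x * (c *\<^sub>C y) = c *\<^sub>C (x * y)"
    and norm_scaleC: "norm (c *\<^sub>C x) = cmod c * norm x"
    and star_star: "star (star x) = x"
    and star_add: "star (x + y) = star x + star y"
    and star_scaleC: "star (c *\<^sub>C x) = cnj c *\<^sub>C star x"
    and star_mult: "star (x * y) = star y * star x"
    and norm_star_mult: "norm (star x * x) = (norm x)\<^sup>2"

definition spectrum :: "'a::unital_cstar_algebra \<Rightarrow> complex set" where
  "spectrum a = {c. \<nexists>b. (a - c *\<^sub>C 1) * b = 1 \<and> b * (a - c *\<^sub>C 1) = 1}"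

definition positive_elements :: "'a::unital_cstar_algebra set" where
  "positive_elements = {a. star a = a \<and> spectrum a \<subseteq> \<real>\<^sub>\<ge>\<^sub>0}"

text \<open>
  The next two operations use the existence and uniqueness of the positive square root of a
  positive element, and the positivity of \<open>star a * a\<close>.
\<close>

definition cstar_sqrt :: "'a::unital_cstar_algebra \<Rightarrow> 'a" where
  "cstar_sqrt a = (THE b. b \<in> positive_elements \<and> b * b = a)"

definition cstar_abs :: "'a::unital_cstar_algebra \<Rightarrow> 'a" where
  "cstar_abs a = cstar_sqrt (star a * a)"

definition positive_linear_functional :: "('a::unital_cstar_algebra \<Rightarrow> complex) \<Rightarrow> bool" where
  "positive_linear_functional \<tau> \<longleftrightarrow>
     (\<forall>a b. \<tau> (a + b) = \<tau> a + \<tau> b) \<and>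
     (\<forall>c a. \<tau> (c *\<^sub>C a) = c * \<tau> a) \<and>
     (\<forall>a\<in>positive_elements. \<tau> a \<in> \<real>\<^sub>\<ge>\<^sub>0)"

definition faithful_trace :: "('a::unital_cstar_algebra \<Rightarrow> complex) \<Rightarrow> bool" where
  "faithful_trace \<tau> \<longleftrightarrow>
     positive_linear_functional \<tau> \<and>
     (\<forall>a b. \<tau> (a * b) = \<tau> (b * a)) \<and>
     (\<forall>a. \<tau> (star a * a) = 0 \<longrightarrow> a = 0)"

definition faithful_tracial_state :: "('a::unital_cstar_algebra \<Rightarrow> complex) \<Rightarrow> bool" where
  "faithful_tracial_state \<tau> \<longleftrightarrow> faithful_trace \<tau> \<and> \<tau> 1 = 1"

definition density_space :: "('a::unital_cstar_algebra \<Rightarrow> complex) \<Rightarrow> 'a set" where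
  "density_space \<tau> = {a \<in> positive_elements. \<tau> a = 1}"

definition cstar_dist :: "'a::unital_cstar_algebra \<Rightarrow> 'a \<Rightarrow> real" where
  "cstar_dist x y = norm (x - y)"

text \<open>
  The functional is complex-valued; its value at the positive element
  \<open>cstar_abs (cstar_sqrt x * cstar_sqrt y)\<close> is real, so \<^const>\<open>Re\<close> loses nothing.
\<close>

definition bures_dist :: "('a::unital_cstar_algebra \<Rightarrow> complex) \<Rightarrow> 'a \<Rightarrow> 'a \<Rightarrow> real" where
  "bures_dist \<tau> x y = sqrt (1 - Re (\<tau> (cstar_abs (cstar_sqrt x * cstar_sqrt y))))"

text \<open>
  The constant \<^const>\<open>Metric_space.mtopology\<close> lives in a locale whose assumptions contain the
  triangle inequality, and its defining equation is only available under them.  The following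
  is the same topology for an arbitrary distance function, so that it can be written down
  for \<^const>\<open>bures_dist\<close> without presupposing that this is a metric.
\<close>

definition metric_topology :: "'a set \<Rightarrow> ('a \<Rightarrow> 'a \<Rightarrow> real) \<Rightarrow> 'a topology" where
  "metric_topology M d =
     topology (\<lambda>U. U \<subseteq> M \<and> (\<forall>x\<in>U. \<exists>r>0. {y \<in> M. d x y < r} \<subseteq> U))"

lemma openin_metric_topology:
  "openin (metric_topology M d) U \<longleftrightarrow> U \<subseteq> M \<and> (\<forall>x\<in>U. \<exists>r>0. {y \<in> M. d x y < r} \<subseteq> U)"
proof -
  let ?O = "\<lambda>U. U \<subseteq> M \<and> (\<forall>x\<in>U. \<exists>r>0. {y \<in> M. d x y < r} \<subseteq> U)"
  have "?O (S \<inter> T)" if "?O S" "?O T" for S T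
  proof (intro conjI ballI)
    fix x assume "x \<in> S \<inter> T"
    with that obtain r s where "r > 0" "{y \<in> M. d x y < r} \<subseteq> S"
      and "s > 0" "{y \<in> M. d x y < s} \<subseteq> T" by blast
    then show "\<exists>r>0. {y \<in> M. d x y < r} \<subseteq> S \<inter> T"
      by (intro exI[of _ "min r s"]) auto
  qed (use that in blast)
  moreover have "?O (\<Union>\<K>)" if "\<forall>K\<in>\<K>. ?O K" for \<K>
  proof (intro conjI ballI)
    fix x assume "x \<in> \<Union>\<K>"
    with that show "\<exists>r>0. {y \<in> M. d x y < r} \<subseteq> \<Union>\<K>" by (meson UnionE Union_upper subset_trans)
  qed (use that in blast)
  ultimately have "istopology ?O" unfolding istopology_def by blast
  then show ?thesis by (simp add: metric_topology_def)
qed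

lemma metric_topology_eq_mtopology:
  assumes "Metric_space M d"
  shows "metric_topology M d = Metric_space.mtopology M d"
proof -
  have "x \<in> M \<Longrightarrow> Metric_space.mball M d x r = {y \<in> M. d x y < r}" for x r
    using assms by (auto simp: Metric_space.mball_def)
  then show ?thesis
    unfolding topology_eq openin_metric_topology Metric_space.openin_mtopology[OF assms]
    by (metis subsetD)
qed

text \<open>\<open>T1\<close> is finer than \<open>T2\<close>, in the non-strict sense.\<close>

definition finer_topology :: "'a topology \<Rightarrow> 'a topology \<Rightarrow> bool" where
  "finer_topology T1 T2 \<longleftrightarrow> (\<forall>U. openin T2 U \<longrightarrow> openin T1 U)"

end

theory Submission
  imports Defs
begin

text \<open>
  The Bures distance from \<open>x\<close> to \<open>y\<close> is built from \<open>y\<close> by norm-continuous operations, and it is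
  \<open>0\<close> at \<open>y = x\<close>.  Since positive square roots depend continuously on the element, \<open>y \<rightarrow> x\<close> in
  norm forces \<open>\<surd>x\<surd>y \<rightarrow> x\<close>, hence \<open>\<bar>\<surd>x\<surd>y\<bar> \<rightarrow> \<bar>x\<bar> = x\<close>, hence \<open>\<tau>(\<bar>\<surd>x\<surd>y\<bar>) \<rightarrow> \<tau>(x) = 1\<close>, because
  a positive functional is norm-continuous.  So every Bures ball around \<open>x\<close> contains a norm ball
  around \<open>x\<close>.

  What has to be built is the theory of positive square roots, from the definition of positivity
  by the spectrum.  It rests on three ideas.

  First, the iteration \<open>y \<mapsto> (k + y\<^sup>2)/2\<close> converges uniformly on the unit ball to some \<open>y\<close> with
  \<open>(1 - y)\<^sup>2 = 1 - k\<close>.  This gives square roots in any Banach algebra, commuting with whatever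
  commutes with \<open>k\<close>; as a uniform limit of continuous maps, the root is continuous in \<open>k\<close>
  (\<open>continuous_on_sqrt_limit\<close>).

  Second, the norm of a self-adjoint \<open>h\<close> is attained in its spectrum up to sign
  (\<open>norm_attained_in_spectrum\<close>).  The same square roots prove this: otherwise
  \<open>\<parallel>h\<parallel>\<^sup>2 - \<delta> - h\<^sup>2\<close> would still have a self-adjoint root for some \<open>\<delta> > 0\<close>, and completing \<open>h\<close> by
  it to a multiple of a unitary would give \<open>\<parallel>h\<parallel>\<^sup>2 \<le> \<parallel>h\<parallel>\<^sup>2 - \<delta>\<close>.  It follows that a self-adjoint \<open>h\<close> with \<open>\<parallel>h\<parallel> \<le> t\<close> is positive exactly
  when \<open>\<parallel>t - h\<parallel> \<le> t\<close>, from which sums and limits of positive elements are positive, and square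
  roots of positive elements exist and are unique.

  Third, \<open>\<bar>\<surd>x\<surd>y\<bar>\<close> is the root of \<open>\<surd>y x \<surd>y\<close>, so that element must be positive.  As \<open>1 + a b\<close> and
  \<open>1 + b a\<close> are invertible together, it is enough to invert \<open>1 + p q\<close> for positive \<open>p\<close> and \<open>q\<close>; if
  \<open>p\<close> is invertible, this is \<open>p (p\<^sup>-\<^sup>1 + q)\<close>, a product of invertible elements
  (\<open>invertible_one_plus_positive_mult\<close>).
\<close>

section \<open>Invertible elements\<close>

definition invertible_element :: "'a::ring_1 \<Rightarrow> bool" where
  "invertible_element a \<longleftrightarrow> (\<exists>b. a * b = 1 \<and> b * a = 1)"

lemma invertible_elementI:
  assumes "a * b = 1" and "c * a = 1"
  shows "invertible_element a"
proof -
  have "c = b" using assms by (metis mult.assoc mult_1_left mult_1_right)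
  then show ?thesis using assms unfolding invertible_element_def by blast
qed

lemma invertible_element_mult:
  assumes "invertible_element a" and "invertible_element b"
  shows "invertible_element (a * b)"
proof -
  obtain c d where c: "a * c = 1" "c * a = 1" and d: "b * d = 1" "d * b = 1"
    using assms unfolding invertible_element_def by blast
  have "(a * b) * (d * c) = a * (b * d) * c" by (simp only: mult.assoc)
  moreover have "(d * c) * (a * b) = d * (c * a) * b" by (simp only: mult.assoc)
  ultimately show ?thesis by (intro invertible_elementI[of _ "d * c" "d * c"]) (simp_all add: c d)
qed

lemma invertible_element_commuting_factor:
  assumes "invertible_element (a * b)" and "a * b = b * a"
  shows "invertible_element a"
proof -
  obtain w where w: "a * b * w = 1" "w * (a * b) = 1"
    using assms(1) unfolding invertible_element_def by blast
  have "a * (b * w) = 1" using w(1) by (simp only: mult.assoc)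
  moreover have "w * b * a = 1" using w(2) by (simp only: mult.assoc assms(2))
  ultimately show ?thesis by (rule invertible_elementI)
qed

lemma invertible_element_scaleR_iff:
  fixes a :: "'a::real_algebra_1"
  assumes "r \<noteq> 0"
  shows "invertible_element (r *\<^sub>R a) \<longleftrightarrow> invertible_element a"
proof -
  have *: "invertible_element (s *\<^sub>R b)" if "invertible_element b" "s \<noteq> 0" for s and b :: 'a
  proof -
    obtain c where "b * c = 1" "c * b = 1" using \<open>invertible_element b\<close> unfolding invertible_element_def by blast
    then show ?thesis
      using \<open>s \<noteq> 0\<close> by (intro invertible_elementI[of _ "inverse s *\<^sub>R c" "inverse s *\<^sub>R c"]) simp_all
  qed
  show ?thesis using *[of a r] *[of "r *\<^sub>R a" "inverse r"] assms by auto
qed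

text \<open>
  If \<open>w\<close> inverts \<open>1 + a b\<close>, then \<open>1 - b w a\<close> inverts \<open>1 + b a\<close>, as comparing the geometric series
  of both inverses suggests.
\<close>

lemma invertible_element_one_plus_swap:
  fixes a b :: "'a::ring_1"
  assumes "invertible_element (1 + a * b)"
  shows "invertible_element (1 + b * a)"
proof -
  obtain w where w: "(1 + a * b) * w = 1" "w * (1 + a * b) = 1"
    using assms unfolding invertible_element_def by blast
  have "(1 + b * a) * (1 - b * w * a) = 1 + b * a - b * ((1 + a * b) * w) * a"
    by (simp add: algebra_simps)
  moreover have "(1 - b * w * a) * (1 + b * a) = 1 + b * a - b * (w * (1 + a * b)) * a"
    by (simp add: algebra_simps)
  ultimately show ?thesis
    using w by (intro invertible_elementI[of _ "1 - b * w * a" "1 - b * w * a"]) auto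
qed

lemma invertible_element_one_minus:
  fixes x :: "'a::{real_normed_algebra_1,banach}"
  assumes "norm x < 1"
  shows "invertible_element (1 - x)"
proof -
  have s: "summable (\<lambda>n. x ^ n)" using assms by (rule complete_algebra_summable_geometric)
  have shift: "(\<Sum>n. x ^ n) = 1 + (\<Sum>n. x ^ Suc n)"
    using suminf_split_head[OF s] by simp
  have "(\<Sum>n. x ^ Suc n) = x * (\<Sum>n. x ^ n)"
    using suminf_mult[OF s, of x] by simp
  moreover have "(\<Sum>n. x ^ Suc n) = (\<Sum>n. x ^ n) * x"
    using suminf_mult2[OF s, of x] by (simp add: power_commutes)
  ultimately show ?thesis
    using shift by (intro invertible_elementI[of _ "\<Sum>n. x ^ n" "\<Sum>n. x ^ n"]) (auto simp: algebra_simps)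
qed

lemma of_real_commute: "of_real r * (a::'a::real_algebra_1) = a * of_real r"
  by (simp add: of_real_def)

lemma invertible_element_of_real_minus:
  fixes a :: "'a::{real_normed_algebra_1,banach}"
  assumes "norm a < \<bar>r\<bar>"
  shows "invertible_element (of_real r - a)"
proof -
  have r: "r \<noteq> 0" using assms norm_ge_zero[of a] by linarith
  have "norm (inverse r *\<^sub>R a) < 1" using assms r by (simp add: divide_simps)
  then have "invertible_element (r *\<^sub>R (1 - inverse r *\<^sub>R a))"
    using invertible_element_one_minus invertible_element_scaleR_iff r by blast
  then show ?thesis using r by (simp add: algebra_simps of_real_def)
qed

section \<open>Involution and spectrum\<close>

lemma star_zero [simp]: "star (0::'a::unital_cstar_algebra) = 0"
  using star_add[of "0::'a" 0] by simp

lemma star_minus: "star (- a) = - star (a::'a::unital_cstar_algebra)"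
  using star_add[of a "- a"] by (simp add: eq_neg_iff_add_eq_0 add.commute)

lemma star_diff: "star (a - b) = star a - star (b::'a::unital_cstar_algebra)"
  using star_add[of a "- b"] by (simp add: star_minus)

lemma star_one [simp]: "star (1::'a::unital_cstar_algebra) = 1"
  by (metis mult_1_left mult_1_right star_mult star_star)

lemma star_scaleR: "star (r *\<^sub>R a) = r *\<^sub>R star (a::'a::unital_cstar_algebra)"
  by (metis complex_cnj_complex_of_real scaleC_of_real star_scaleC)

lemma star_of_real [simp]: "star (of_real r :: 'a::unital_cstar_algebra) = of_real r"
  by (simp add: of_real_def star_scaleR)

lemma selfadjoint_inverse:
  assumes "star a = a" and v: "a * v = 1" "v * a = 1"
  shows "star v = v"
proof -
  have "star v * a = 1" using arg_cong[OF v(1), of star] assms(1) by (simp add: star_mult)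
  then show ?thesis using v(1) by (metis mult.assoc mult_1_left mult_1_right)
qed

lemma norm_star [simp]: "norm (star a) = norm (a::'a::unital_cstar_algebra)"
proof -
  have "norm b \<le> norm (star b)" for b :: 'a
  proof (cases "b = 0")
    case False
    have "norm b * norm b \<le> norm (star b) * norm b"
      using norm_star_mult[of b] norm_mult_ineq[of "star b" b] by (simp add: power2_eq_square)
    then show ?thesis using False by simp
  qed simp
  from this[of a] this[of "star a"] show ?thesis by (simp add: star_star)
qed

lemma bounded_linear_star: "bounded_linear (star :: 'a::unital_cstar_algebra \<Rightarrow> 'a)"
  by (rule bounded_linear_intro[where K = 1]) (simp_all add: star_add star_scaleR)

lemmas tendsto_star = bounded_linear.tendsto[OF bounded_linear_star]

lemma scaleC_zero [simp]: "0 *\<^sub>C (a::'a::unital_cstar_algebra) = 0"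
  using scaleC_of_real[of 0 a] by simp

lemma scaleC_one [simp]: "1 *\<^sub>C (a::'a::unital_cstar_algebra) = a"
  using scaleC_of_real[of 1 a] by simp

lemma scaleC_minus_left: "(- c) *\<^sub>C (a::'a::unital_cstar_algebra) = - (c *\<^sub>C a)"
  using scaleC_add_left[of c "- c" a] by (simp add: eq_neg_iff_add_eq_0 add.commute)

lemma scaleC_minus_right: "c *\<^sub>C (- (a::'a::unital_cstar_algebra)) = - (c *\<^sub>C a)"
  by (metis mult_minus1 scaleC_mult_right)

lemma scaleC_of_real_one: "complex_of_real r *\<^sub>C (1::'a::unital_cstar_algebra) = of_real r"
  unfolding scaleC_of_real by (simp add: of_real_def)

lemma in_spectrum_iff: "c \<in> spectrum a \<longleftrightarrow> \<not> invertible_element (a - c *\<^sub>C 1)"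
  by (simp add: spectrum_def invertible_element_def)

lemma cmod_spectrum_le_norm:
  fixes a :: "'a::unital_cstar_algebra"
  assumes "c \<in> spectrum a"
  shows "cmod c \<le> norm a"
proof (rule ccontr)
  assume "\<not> cmod c \<le> norm a"
  then have c: "c \<noteq> 0" and less: "norm a < cmod c" by auto
  have "norm (inverse c *\<^sub>C a) < 1"
    using less c by (simp add: norm_scaleC norm_inverse inverse_eq_divide norm_divide)
  then have inv1: "invertible_element (1 - inverse c *\<^sub>C a)" by (rule invertible_element_one_minus)
  have inv2: "invertible_element ((- c) *\<^sub>C (1::'a))"
    using c by (intro invertible_elementI[of _ "(- inverse c) *\<^sub>C 1" "(- inverse c) *\<^sub>C 1"])
      (simp_all add: scaleC_mult_left scaleC_mult_right scaleC_scaleC)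
  have "(- c) *\<^sub>C (1::'a) * (1 - inverse c *\<^sub>C a) = a - c *\<^sub>C 1"
    using c by (simp add: scaleC_mult_left scaleC_mult_right scaleC_scaleC algebra_simps
        scaleC_minus_left scaleC_minus_right)
  with invertible_element_mult[OF inv2 inv1] assms show False by (simp add: in_spectrum_iff)
qed

text \<open>
  Adding \<open>i s\<close> shifts the spectral value \<open>c\<close> to \<open>c + i s\<close>, while \<open>\<parallel>h + i s\<parallel>\<^sup>2 \<le> \<parallel>h\<parallel>\<^sup>2 + s\<^sup>2\<close> by the
  C*-identity.  The term \<open>2 s Im c\<close> of \<open>\<bar>c + i s\<bar>\<^sup>2\<close> is linear in \<open>s\<close> and has no counterpart on the
  right, so it must vanish.
\<close>

lemma spectrum_selfadjoint_real:
  fixes h :: "'a::unital_cstar_algebra"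
  assumes h: "star h = h" and c: "c \<in> spectrum h"
  shows "Im c = 0"
proof (rule ccontr)
  assume im: "Im c \<noteq> 0"
  \<comment> \<open>Chosen such that \<open>2 s Im c\<close> exceeds \<open>\<parallel>h\<parallel>\<^sup>2\<close>.\<close>
  define s where "s = ((norm h)\<^sup>2 + 1) / (2 * Im c)"
  define i where "i = Complex 0 s *\<^sub>C (1::'a)"
  define e where "e = h + i"
  have "c + Complex 0 s \<in> spectrum e"
    using c by (simp add: in_spectrum_iff e_def i_def scaleC_add_left)
  then have "cmod (c + Complex 0 s) \<le> norm e" by (rule cmod_spectrum_le_norm)
  then have "(cmod (c + Complex 0 s))\<^sup>2 \<le> (norm e)\<^sup>2" by (intro power_mono) auto
  also have "\<dots> = norm (star e * e)" by (simp add: norm_star_mult)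
  also have "star e * e = h * h + of_real (s\<^sup>2)"
  proof -
    have ih: "i * h = h * i" by (simp add: i_def scaleC_mult_left scaleC_mult_right)
    have "star i = - i"
      by (simp add: i_def star_scaleC complex_cnj complex_minus flip: scaleC_minus_left)
    moreover have "i * i = - of_real (s\<^sup>2)"
    proof -
      have "i * i = (Complex 0 s * Complex 0 s) *\<^sub>C 1"
        by (simp add: i_def scaleC_mult_left scaleC_scaleC)
      also have "Complex 0 s * Complex 0 s = complex_of_real (- (s\<^sup>2))"
        by (simp add: complex_eq_iff power2_eq_square)
      finally show ?thesis by (simp only: scaleC_of_real_one) simp
    qed
    ultimately show ?thesis
      by (simp add: e_def star_add h algebra_simps ih)
  qed
  also have "norm (h * h + of_real (s\<^sup>2)) \<le> (norm h)\<^sup>2 + s\<^sup>2"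
  proof (rule norm_triangle_le)
    have "norm (h * h) \<le> (norm h)\<^sup>2" using norm_mult_ineq[of h h] by (simp add: power2_eq_square)
    moreover have "norm (of_real (s\<^sup>2) :: 'a) = s\<^sup>2" by (simp only: norm_of_real) simp
    ultimately show "norm (h * h) + norm (of_real (s\<^sup>2) :: 'a) \<le> (norm h)\<^sup>2 + s\<^sup>2" by linarith
  qed
  finally have "(Re c)\<^sup>2 + (Im c)\<^sup>2 + 2 * Im c * s \<le> (norm h)\<^sup>2"
    unfolding cmod_power2 by (simp add: power2_eq_square algebra_simps)
  moreover have "2 * Im c * s = (norm h)\<^sup>2 + 1" using im by (simp add: s_def)
  moreover have "0 \<le> (Re c)\<^sup>2 + (Im c)\<^sup>2" by simp
  ultimately show False by linarith
qed

text \<open>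
  Since self-adjoint elements have real spectrum, only the negative real numbers have to be
  excluded from it; this form of positivity is the one used from here on.
\<close>

lemma positive_elements_iff:
  "a \<in> positive_elements \<longleftrightarrow> star a = a \<and> (\<forall>r>0. invertible_element (a + of_real r))"
proof -
  have shift: "complex_of_real (- r) \<in> spectrum a \<longleftrightarrow> \<not> invertible_element (a + of_real r)" for r
  proof -
    have "a - complex_of_real (- r) *\<^sub>C 1 = a + of_real r"
      by (simp only: scaleC_of_real_one) simp
    then show ?thesis by (simp only: in_spectrum_iff)
  qed
  show ?thesis
  proof
    assume a: "a \<in> positive_elements"
    have "invertible_element (a + of_real r)" if "r > 0" for r
    proof (rule ccontr)
      assume "\<not> invertible_element (a + of_real r)"
      then have "complex_of_real (- r) \<in> \<real>\<^sub>\<ge>\<^sub>0"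
        using a shift unfolding positive_elements_def by blast
      then show False using that by (simp only: nonneg_Reals_of_real_iff)
    qed
    then show "star a = a \<and> (\<forall>r>0. invertible_element (a + of_real r))"
      using a by (simp add: positive_elements_def)
  next
    assume a: "star a = a \<and> (\<forall>r>0. invertible_element (a + of_real r))"
    have "c \<in> \<real>\<^sub>\<ge>\<^sub>0" if "c \<in> spectrum a" for c
    proof -
      have c: "c = complex_of_real (- (- Re c))"
        using spectrum_selfadjoint_real[of a c] a that by (simp add: complex_eq_iff)
      with that have "\<not> invertible_element (a + of_real (- Re c))" using shift by metis
      then have "0 \<le> Re c" using a by (meson neg_0_less_iff_less not_le)
      then show ?thesis using c by (simp add: complex_nonneg_Reals_iff complex_eq_iff)
    qed
    then show "a \<in> positive_elements" using a by (auto simp: positive_elements_def)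
  qed
qed

section \<open>A square root by iteration\<close>

text \<open>
  The limit is a fixed point \<open>y = (k + y\<^sup>2)/2\<close>, which says \<open>(1 - y)\<^sup>2 = 1 - k\<close>.  The iterates are
  polynomials in \<open>k\<close> with nonnegative coefficients, so their increments are dominated by those of
  the scalar iteration at \<open>k = 1\<close>, which increases to \<open>1\<close>.
\<close>

primrec sqrt_iter :: "'a::real_normed_algebra_1 \<Rightarrow> nat \<Rightarrow> 'a" where
  "sqrt_iter k 0 = 0"
| "sqrt_iter k (Suc n) = (1/2) *\<^sub>R (k + sqrt_iter k n * sqrt_iter k n)"

lemma sqrt_iter_commute: "z * k = k * z \<Longrightarrow> z * sqrt_iter k n = sqrt_iter k n * z"
proof (induction n)
  case (Suc n)
  then have "z * (sqrt_iter k n * sqrt_iter k n) = sqrt_iter k n * sqrt_iter k n * z"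
    by (metis mult.assoc)
  with Suc.prems show ?case by (simp add: algebra_simps)
qed simp

lemma sqrt_iter_star:
  fixes k :: "'a::unital_cstar_algebra"
  shows "star k = k \<Longrightarrow> star (sqrt_iter k n) = sqrt_iter k n"
  by (induction n) (simp_all add: star_scaleR star_add star_mult)

lemma sqrt_iter_one_bounds: "0 \<le> sqrt_iter (1::real) n \<and> sqrt_iter (1::real) n \<le> 1"
proof (induction n)
  case (Suc n)
  then have "sqrt_iter (1::real) n * sqrt_iter 1 n \<le> 1" by (simp add: mult_le_one)
  then show ?case by simp
qed simp

lemma sqrt_iter_one_mono: "incseq (sqrt_iter (1::real))"
proof (rule incseq_SucI)
  fix n
  show "sqrt_iter (1::real) n \<le> sqrt_iter 1 (Suc n)"
    using zero_le_square[of "1 - sqrt_iter (1::real) n"] by (simp add: algebra_simps)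
qed

lemma sqrt_iter_one_tendsto: "sqrt_iter (1::real) \<longlonglongrightarrow> 1"
proof -
  have bdd: "bdd_above (range (sqrt_iter (1::real)))"
    using sqrt_iter_one_bounds by (intro bdd_aboveI[of _ 1]) auto
  obtain r where r: "sqrt_iter (1::real) \<longlonglongrightarrow> r"
    using LIMSEQ_incseq_SUP[OF bdd sqrt_iter_one_mono] by blast
  have "(\<lambda>n. sqrt_iter (1::real) (Suc n)) \<longlonglongrightarrow> (1/2) *\<^sub>R (1 + r * r)"
    unfolding sqrt_iter.simps by (intro tendsto_intros r)
  then have "r = (1/2) *\<^sub>R (1 + r * r)" using LIMSEQ_Suc[OF r] LIMSEQ_unique by blast
  then have "(r - 1) * (r - 1) = 0" by (simp add: algebra_simps)
  then show ?thesis using r by simp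
qed

lemma norm_sqrt_iter_le:
  assumes "norm k \<le> 1"
  shows "norm (sqrt_iter k n) \<le> sqrt_iter 1 n"
proof (induction n)
  case (Suc n)
  have "norm (sqrt_iter k n * sqrt_iter k n) \<le> sqrt_iter 1 n * sqrt_iter 1 n"
    by (rule order_trans[OF norm_mult_ineq]) (use Suc in \<open>simp add: mult_mono'\<close>)
  then show ?case using norm_triangle_ineq[of k "sqrt_iter k n * sqrt_iter k n"] assms by simp
qed simp

text \<open>
  The iterates commute, so a difference of squares factors; bounding both factors by the
  induction hypothesis and the previous lemma reproduces the same factorization of the scalar
  increment.
\<close>

lemma norm_sqrt_iter_step_le:
  assumes k: "norm k \<le> 1"
  shows "norm (sqrt_iter k (Suc n) - sqrt_iter k n) \<le> sqrt_iter 1 (Suc n) - sqrt_iter 1 n"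
proof (induction n)
  case 0
  then show ?case using k by simp
next
  case (Suc n)
  let ?y = "sqrt_iter k" and ?r = "sqrt_iter (1::real)"
  have "?y (Suc n) * ?y n = ?y n * ?y (Suc n)" by (intro sqrt_iter_commute sqrt_iter_commute[symmetric]) simp
  then have "?y (Suc (Suc n)) - ?y (Suc n) = (1/2) *\<^sub>R ((?y (Suc n) + ?y n) * (?y (Suc n) - ?y n))"
    unfolding sqrt_iter.simps(2)[of k "Suc n"] sqrt_iter.simps(2)[of k n]
    by (simp add: algebra_simps del: sqrt_iter.simps)
  also have "norm \<dots> \<le> (1/2) * (norm (?y (Suc n) + ?y n) * norm (?y (Suc n) - ?y n))"
    using norm_mult_ineq[of "?y (Suc n) + ?y n" "?y (Suc n) - ?y n"] by (simp del: sqrt_iter.simps)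
  also have "\<dots> \<le> (1/2) * ((?r (Suc n) + ?r n) * (?r (Suc n) - ?r n))"
  proof (intro mult_left_mono mult_mono)
    show "norm (?y (Suc n) + ?y n) \<le> ?r (Suc n) + ?r n"
      using norm_triangle_ineq[of "?y (Suc n)" "?y n"] norm_sqrt_iter_le[OF k, of "Suc n"] norm_sqrt_iter_le[OF k, of n]
      by linarith
    show "0 \<le> ?r (Suc n) + ?r n" using sqrt_iter_one_bounds[of n] sqrt_iter_one_bounds[of "Suc n"] by linarith
  qed (use Suc in auto)
  also have "\<dots> = ?r (Suc (Suc n)) - ?r (Suc n)" by (simp add: field_simps)
  finally show ?case .
qed

lemma norm_sqrt_iter_diff_le:
  assumes "norm k \<le> 1" and "m \<le> n"
  shows "norm (sqrt_iter k n - sqrt_iter k m) \<le> sqrt_iter 1 n - sqrt_iter 1 m"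
  using assms(2)
proof (induction rule: dec_induct)
  case (step n)
  have "norm (sqrt_iter k (Suc n) - sqrt_iter k m)
        \<le> norm (sqrt_iter k (Suc n) - sqrt_iter k n) + norm (sqrt_iter k n - sqrt_iter k m)"
    by (metis diff_add_cancel add_diff_eq norm_triangle_ineq)
  with step.IH norm_sqrt_iter_step_le[OF assms(1), of n] show ?case by linarith
qed simp

definition sqrt_limit :: "'a::real_normed_algebra_1 \<Rightarrow> 'a" where
  "sqrt_limit k = lim (sqrt_iter k)"

lemma norm_sqrt_iter_diff_le':
  assumes "norm k \<le> 1" and "m \<le> n"
  shows "norm (sqrt_iter k n - sqrt_iter k m) \<le> 1 - sqrt_iter 1 m"
  using norm_sqrt_iter_diff_le[OF assms] sqrt_iter_one_bounds[of n] by linarith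

lemma sqrt_iter_tendsto:
  fixes k :: "'a::{real_normed_algebra_1,banach}"
  assumes k: "norm k \<le> 1"
  shows "sqrt_iter k \<longlonglongrightarrow> sqrt_limit k"
proof -
  have "Cauchy (sqrt_iter k)"
  proof (rule CauchyI')
    fix e :: real assume "0 < e"
    then have "\<forall>\<^sub>F m in sequentially. 1 - e < sqrt_iter (1::real) m"
      using order_tendstoD(1)[OF sqrt_iter_one_tendsto, of "1 - e"] by simp
    then obtain M where M: "\<And>m. m \<ge> M \<Longrightarrow> 1 - e < sqrt_iter (1::real) m"
      by (auto simp: eventually_sequentially)
    have "dist (sqrt_iter k m) (sqrt_iter k n) < e" if "M \<le> m" "m < n" for m n
      using norm_sqrt_iter_diff_le'[OF k, of m n] M[OF that(1)] that(2)
      by (simp add: dist_norm norm_minus_commute)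
    then show "\<exists>M. \<forall>m\<ge>M. \<forall>n>m. dist (sqrt_iter k m) (sqrt_iter k n) < e" by blast
  qed
  then have "convergent (sqrt_iter k)" by (rule Cauchy_convergent)
  then show ?thesis unfolding sqrt_limit_def by (rule convergent_LIMSEQ_iff[THEN iffD1])
qed

lemma norm_sqrt_limit_diff_le:
  fixes k :: "'a::{real_normed_algebra_1,banach}"
  assumes k: "norm k \<le> 1"
  shows "norm (sqrt_limit k - sqrt_iter k m) \<le> 1 - sqrt_iter 1 m"
proof (rule tendsto_upperbound)
  show "(\<lambda>n. norm (sqrt_iter k n - sqrt_iter k m)) \<longlonglongrightarrow> norm (sqrt_limit k - sqrt_iter k m)"
    by (intro tendsto_intros sqrt_iter_tendsto k)
  show "\<forall>\<^sub>F n in sequentially. norm (sqrt_iter k n - sqrt_iter k m) \<le> 1 - sqrt_iter 1 m"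
    using norm_sqrt_iter_diff_le'[OF k] by (auto simp: eventually_sequentially)
qed simp

lemma sqrt_limit_square:
  fixes k :: "'a::{real_normed_algebra_1,banach}"
  assumes k: "norm k \<le> 1"
  shows "(1 - sqrt_limit k) * (1 - sqrt_limit k) = 1 - k"
proof -
  let ?y = "sqrt_limit k"
  have "(\<lambda>n. sqrt_iter k (Suc n)) \<longlonglongrightarrow> (1/2) *\<^sub>R (k + ?y * ?y)"
    unfolding sqrt_iter.simps by (intro tendsto_intros sqrt_iter_tendsto k)
  then have "?y = (1/2) *\<^sub>R (k + ?y * ?y)"
    using LIMSEQ_Suc[OF sqrt_iter_tendsto[OF k]] LIMSEQ_unique by blast
  then have "2 *\<^sub>R ?y = k + ?y * ?y" by (metis scaleR_half_double scaleR_2 scaleR_right_distrib)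
  then show ?thesis by (simp add: algebra_simps scaleR_2)
qed

lemma sqrt_limit_commute:
  fixes k :: "'a::{real_normed_algebra_1,banach}"
  assumes k: "norm k \<le> 1" and "z * k = k * z"
  shows "z * sqrt_limit k = sqrt_limit k * z"
proof -
  have "(\<lambda>n. z * sqrt_iter k n) \<longlonglongrightarrow> z * sqrt_limit k"
    by (intro tendsto_intros sqrt_iter_tendsto k)
  moreover have "(\<lambda>n. z * sqrt_iter k n) \<longlonglongrightarrow> sqrt_limit k * z"
    unfolding sqrt_iter_commute[OF assms(2)] by (intro tendsto_intros sqrt_iter_tendsto k)
  ultimately show ?thesis by (rule LIMSEQ_unique)
qed

lemma sqrt_limit_star:
  fixes k :: "'a::unital_cstar_algebra"
  assumes k: "norm k \<le> 1" and "star k = k"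
  shows "star (sqrt_limit k) = sqrt_limit k"
proof -
  have "(\<lambda>n. star (sqrt_iter k n)) \<longlonglongrightarrow> star (sqrt_limit k)"
    by (intro tendsto_star sqrt_iter_tendsto k)
  then show ?thesis
    unfolding sqrt_iter_star[OF assms(2)] using sqrt_iter_tendsto[OF k] LIMSEQ_unique by blast
qed

lemma continuous_on_sqrt_limit:
  "continuous_on (cball 0 1) (sqrt_limit :: 'a::{real_normed_algebra_1,banach} \<Rightarrow> 'a)"
proof (rule uniform_limit_theorem)
  have "continuous_on A (\<lambda>k. sqrt_iter k n)" for A :: "'a set" and n
    by (induction n) (auto intro!: continuous_intros)
  then show "\<forall>\<^sub>F n in sequentially. continuous_on (cball 0 1) (\<lambda>k::'a. sqrt_iter k n)" by simp
  show "uniform_limit (cball 0 1) (\<lambda>n k. sqrt_iter k n) (sqrt_limit :: 'a \<Rightarrow> 'a) sequentially"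
  proof (rule uniform_limitI)
    fix e :: real assume "0 < e"
    then have "\<forall>\<^sub>F n in sequentially. 1 - e < sqrt_iter (1::real) n"
      using order_tendstoD(1)[OF sqrt_iter_one_tendsto, of "1 - e"] by simp
    then show "\<forall>\<^sub>F n in sequentially. \<forall>k\<in>cball 0 1. dist (sqrt_iter k n) (sqrt_limit k :: 'a) < e"
    proof eventually_elim
      case (elim n)
      show ?case
      proof
        fix k :: 'a assume "k \<in> cball 0 1"
        then have "norm (sqrt_limit k - sqrt_iter k n) \<le> 1 - sqrt_iter 1 n"
          by (intro norm_sqrt_limit_diff_le) simp
        with elim show "dist (sqrt_iter k n) (sqrt_limit k) < e"
          by (simp add: dist_norm norm_minus_commute)
      qed
    qed
  qed
qed simp

text \<open>
  The root of \<open>a\<close> obtained by writing \<open>a = t (1 - k)\<close>.  Any \<open>t\<close> with \<open>\<parallel>t - a\<parallel> \<le> t\<close> will do; a \<open>t\<close>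
  that is fixed while \<open>a\<close> varies makes continuity in \<open>a\<close> visible.
\<close>

definition iter_sqrt :: "real \<Rightarrow> 'a::{real_normed_algebra_1,banach} \<Rightarrow> 'a" where
  "iter_sqrt t a = sqrt t *\<^sub>R (1 - sqrt_limit (1 - inverse t *\<^sub>R a))"

lemma norm_rescaled:
  fixes a :: "'a::{real_normed_algebra_1,banach}"
  assumes "0 < t" and "norm (of_real t - a) \<le> t"
  shows "norm (1 - inverse t *\<^sub>R a) \<le> 1"
proof -
  have "1 - inverse t *\<^sub>R a = inverse t *\<^sub>R (of_real t - a)"
    using assms(1) by (simp add: of_real_def algebra_simps)
  then have "norm (1 - inverse t *\<^sub>R a) = norm (of_real t - a) / t"
    using assms(1) by (simp add: divide_inverse_commute)
  then show ?thesis using assms by simp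
qed

lemma
  fixes a :: "'a::{real_normed_algebra_1,banach}"
  assumes t: "0 < t" and a: "norm (of_real t - a) \<le> t"
  shows iter_sqrt_square: "iter_sqrt t a * iter_sqrt t a = a"
    and iter_sqrt_commute: "z * a = a * z \<Longrightarrow> z * iter_sqrt t a = iter_sqrt t a * z"
    and norm_iter_sqrt_le: "norm (of_real (sqrt t) - iter_sqrt t a) \<le> sqrt t"
proof -
  note k = norm_rescaled[OF t a]
  show "iter_sqrt t a * iter_sqrt t a = a"
    using t sqrt_limit_square[OF k] by (simp add: iter_sqrt_def flip: mult.assoc)
  show "z * iter_sqrt t a = iter_sqrt t a * z" if "z * a = a * z"
    using sqrt_limit_commute[OF k, of z] that by (simp add: iter_sqrt_def algebra_simps)
  have "of_real (sqrt t) - iter_sqrt t a = sqrt t *\<^sub>R sqrt_limit (1 - inverse t *\<^sub>R a)"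
    by (simp add: iter_sqrt_def of_real_def algebra_simps)
  then show "norm (of_real (sqrt t) - iter_sqrt t a) \<le> sqrt t"
    using t norm_sqrt_limit_diff_le[OF k, of 0] by simp
qed

lemma iter_sqrt_star:
  fixes a :: "'a::unital_cstar_algebra"
  assumes "0 < t" and "norm (of_real t - a) \<le> t" and "star a = a"
  shows "star (iter_sqrt t a) = iter_sqrt t a"
  using sqrt_limit_star[OF norm_rescaled[OF assms(1,2)]] assms(3)
  by (simp add: iter_sqrt_def star_scaleR star_diff)

lemma continuous_on_iter_sqrt:
  assumes "0 < t"
  shows "continuous_on {a :: 'a::{real_normed_algebra_1,banach}. norm (of_real t - a) \<le> t} (iter_sqrt t)"
  unfolding iter_sqrt_def
  by (intro continuous_intros continuous_on_compose2[OF continuous_on_sqrt_limit])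
    (auto simp: norm_rescaled[OF assms])

section \<open>Positive elements\<close>

text \<open>
  With \<open>u = h + i p\<close> the hypotheses say \<open>u\<^sup>* u = r\<close>, so \<open>\<parallel>u\<parallel>\<^sup>2 = \<bar>r\<bar>\<close>, and \<open>h\<close> is the mean of \<open>u\<close>
  and \<open>u\<^sup>*\<close>.
\<close>

lemma norm_le_of_commuting_squares:
  fixes h :: "'a::unital_cstar_algebra"
  assumes h: "star h = h" and p: "star p = p" and hp: "h * p = p * h"
    and sum: "h * h + p * p = of_real r"
  shows "(norm h)\<^sup>2 \<le> \<bar>r\<bar>"
proof -
  define j where "j = Complex 0 1 *\<^sub>C p"
  have star_j: "star j = - j"
    by (simp add: j_def star_scaleC p complex_cnj complex_minus flip: scaleC_minus_left)
  have "j * j = (Complex 0 1 * Complex 0 1) *\<^sub>C (p * p)"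
    by (simp add: j_def scaleC_mult_left scaleC_mult_right scaleC_scaleC)
  also have "Complex 0 1 * Complex 0 1 = - 1" by (simp add: complex_eq_iff)
  finally have jj: "j * j = - (p * p)" by (simp add: scaleC_minus_left)
  have hj: "h * j = j * h" by (simp add: j_def scaleC_mult_left scaleC_mult_right hp)
  have "(norm (h + j))\<^sup>2 = norm (star (h + j) * (h + j))" by (simp add: norm_star_mult)
  also have "star (h + j) * (h + j) = of_real r"
    using sum by (simp add: star_add h star_j algebra_simps jj hj)
  finally have eq: "(norm (h + j))\<^sup>2 = \<bar>r\<bar>" by simp
  have "2 *\<^sub>R h = (h + j) + star (h + j)" by (simp add: star_add h star_j scaleR_2)
  then have "2 * norm h \<le> norm (h + j) + norm (star (h + j))"
    by (metis norm_scaleR norm_triangle_ineq abs_numeral)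
  then have "norm h \<le> norm (h + j)" by simp
  then show ?thesis unfolding eq[symmetric] by (intro power_mono) auto
qed

text \<open>
  Put \<open>N = \<parallel>h\<parallel>\<close>.  If both elements were invertible, so would be their product \<open>a = N\<^sup>2 - h\<^sup>2\<close>.  The
  iteration yields a self-adjoint root \<open>s\<close> of \<open>a\<close>, and for small \<open>\<delta> > 0\<close> a root \<open>w\<close> of
  \<open>1 - \<delta> a\<^sup>-\<^sup>1\<close>.  Then \<open>(s w)\<^sup>2 = a - \<delta>\<close>, that is, \<open>h\<^sup>2 + (s w)\<^sup>2 = N\<^sup>2 - \<delta>\<close>, and the preceding lemma
  gives the contradiction \<open>N\<^sup>2 \<le> N\<^sup>2 - \<delta>\<close>.
\<close>

lemma norm_attained_in_spectrum:
  fixes h :: "'a::unital_cstar_algebra"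
  assumes h: "star h = h"
  shows "\<not> (invertible_element (of_real (norm h) - h) \<and> invertible_element (of_real (norm h) + h))"
proof
  define N where "N = norm h"
  assume inv: "invertible_element (of_real (norm h) - h) \<and> invertible_element (of_real (norm h) + h)"
  have N: "0 < N"
  proof (rule ccontr)
    assume "\<not> 0 < N"
    then have "h = 0" by (simp add: N_def)
    with inv show False by (simp add: invertible_element_def)
  qed
  define a where "a = of_real (N\<^sup>2) - h * h"
  have "(of_real N - h) * (of_real N + h) = a"
    by (simp add: a_def algebra_simps of_real_commute[of N h] power2_eq_square)
  then have inv_a: "invertible_element a"
    using invertible_element_mult inv unfolding N_def by metis
  have star_a: "star a = a" by (simp add: a_def star_diff star_mult h del: of_real_power)
  have ha: "h * a = a * h" by (simp add: a_def algebra_simps of_real_commute[of _ h] del: of_real_power)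
  have a_le: "norm (of_real (N\<^sup>2) - a) \<le> N\<^sup>2"
    using norm_mult_ineq[of h h] by (simp add: a_def N_def power2_eq_square)
  define s where "s = iter_sqrt (N\<^sup>2) a"
  have N2: "0 < N\<^sup>2" using N by simp
  have ss: "s * s = a" and hs: "h * s = s * h" and star_s: "star s = s"
    unfolding s_def using iter_sqrt_square[OF N2 a_le] iter_sqrt_commute[OF N2 a_le ha]
      iter_sqrt_star[OF N2 a_le star_a] by auto
  obtain v where v: "a * v = 1" "v * a = 1" using inv_a unfolding invertible_element_def by blast
  have commute_v: "z * v = v * z" if "z * a = a * z" for z
    using that v by (metis mult.assoc mult_1_left mult_1_right)
  have star_v: "star v = v" using star_a v by (rule selfadjoint_inverse)
  \<comment> \<open>The first bound keeps \<open>N\<^sup>2 - \<delta>\<close> positive, the second makes \<open>\<parallel>\<delta> v\<parallel> \<le> 1\<close>, so that the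
    iteration applies to \<open>1 - \<delta> v\<close>.\<close>
  define \<delta> where "\<delta> = min (N\<^sup>2 / 2) (1 / (norm v + 1))"
  have nv: "0 < norm v + 1" using norm_ge_zero[of v] by linarith
  have \<delta>: "0 < \<delta>" "\<delta> < N\<^sup>2" using N nv by (auto simp: \<delta>_def min_less_iff_disj)
  have "\<delta> * norm v \<le> 1 / (norm v + 1) * norm v" by (intro mult_right_mono) (auto simp: \<delta>_def)
  also have "\<dots> \<le> 1" using nv by (simp add: field_simps)
  finally have b_le: "norm (of_real 1 - (1 - \<delta> *\<^sub>R v)) \<le> 1" using \<delta> by simp
  define w where "w = iter_sqrt 1 (1 - \<delta> *\<^sub>R v)"
  have ww: "w * w = 1 - \<delta> *\<^sub>R v" and star_w: "star w = w"
    and commute_w: "z * w = w * z" if "z * a = a * z" for z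
    unfolding w_def using iter_sqrt_square[OF zero_less_one b_le] iter_sqrt_commute[OF zero_less_one b_le, of z]
      iter_sqrt_star[OF zero_less_one b_le] commute_v[OF that]
    by (auto simp: star_diff star_scaleR star_v algebra_simps)
  have sa: "s * a = a * s" and hv: "h * w = w * h" and sw: "s * w = w * s"
    using commute_w[OF ha] commute_w[of s] ss by (auto simp: mult.assoc)
  define p where "p = s * w"
  have star_p: "star p = p" by (simp add: p_def star_mult star_s star_w sw)
  have hp: "h * p = p * h" unfolding p_def by (metis hs hv mult.assoc)
  have "p * p = (s * s) * (w * w)" unfolding p_def by (metis sw mult.assoc)
  also have "\<dots> = a - of_real \<delta>" by (simp add: ss ww algebra_simps v of_real_def)
  finally have "h * h + p * p = of_real (N\<^sup>2 - \<delta>)" by (simp add: a_def)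
  from norm_le_of_commuting_squares[OF h star_p hp this] \<delta> show False by (simp add: N_def)
qed

lemma positive_elements_star: "a \<in> positive_elements \<Longrightarrow> star a = a"
  by (simp add: positive_elements_def)

lemma positive_if_norm_diff_le:
  fixes h :: "'a::unital_cstar_algebra"
  assumes h: "star h = h" and le: "norm (of_real t - h) \<le> t"
  shows "h \<in> positive_elements"
proof -
  have "invertible_element (h + of_real r)" if "r > 0" for r
  proof -
    have "norm (of_real t - h) < \<bar>t + r\<bar>" using le that by linarith
    then have "invertible_element (of_real (t + r) - (of_real t - h))"
      by (rule invertible_element_of_real_minus)
    then show ?thesis by (simp add: algebra_simps)
  qed
  with h show ?thesis by (simp add: positive_elements_iff)
qed

text \<open>
  If \<open>N = \<parallel>t - h\<parallel>\<close> exceeded \<open>t\<close>, then neither \<open>N\<close> nor \<open>-N\<close> could be a spectral value of \<open>t - h\<close>: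
  the first because \<open>h\<close> has no negative spectral value \<open>t - N\<close>, the second because \<open>t + N > \<parallel>h\<parallel>\<close>.
\<close>

lemma norm_diff_le_if_positive:
  fixes h :: "'a::unital_cstar_algebra"
  assumes h: "h \<in> positive_elements" and t: "norm h \<le> t"
  shows "norm (of_real t - h) \<le> t"
proof (rule ccontr)
  define N where "N = norm (of_real t - h)"
  assume "\<not> norm (of_real t - h) \<le> t"
  then have N: "t < N" by (simp add: N_def)
  have "invertible_element (h + of_real (N - t))"
    using h N by (simp add: positive_elements_iff del: of_real_diff)
  then have "invertible_element (of_real N - (of_real t - h))" by (simp add: algebra_simps)
  moreover have "invertible_element (of_real (N + t) - h)"
  proof (rule invertible_element_of_real_minus)
    show "norm h < \<bar>N + t\<bar>" using t N norm_ge_zero[of h] by linarith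
  qed
  then have "invertible_element (of_real N + (of_real t - h))" by (simp add: algebra_simps)
  moreover have "star (of_real t - h) = of_real t - h"
    using h by (simp add: star_diff positive_elements_star)
  ultimately show False using norm_attained_in_spectrum unfolding N_def by blast
qed

lemma positive_elements_add:
  assumes a: "a \<in> positive_elements" and b: "b \<in> positive_elements"
  shows "a + b \<in> positive_elements"
proof (rule positive_if_norm_diff_le)
  have "norm ((of_real (norm a) - a) + (of_real (norm b) - b)) \<le> norm a + norm b"
    by (rule norm_triangle_le) (intro add_mono norm_diff_le_if_positive a b order_refl)
  then show "norm (of_real (norm a + norm b) - (a + b)) \<le> norm a + norm b"
    by (simp add: algebra_simps)
qed (simp add: star_add a b positive_elements_star)

lemma positive_elements_scaleR:
  assumes a: "a \<in> positive_elements" and k: "0 < k"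
  shows "k *\<^sub>R a \<in> positive_elements"
proof -
  have "invertible_element (k *\<^sub>R a + of_real r)" if "r > 0" for r
  proof -
    have "k *\<^sub>R a + of_real r = k *\<^sub>R (a + of_real (r / k))"
      using k by (simp add: of_real_def algebra_simps)
    moreover have "invertible_element (a + of_real (r / k))"
      using a that k by (simp add: positive_elements_iff del: of_real_divide)
    ultimately show ?thesis using k by (simp only: invertible_element_scaleR_iff)
  qed
  with a show ?thesis by (simp add: positive_elements_iff star_scaleR)
qed

text \<open>
  Write \<open>1 + p' q = p' (p'\<^sup>-\<^sup>1 + q)\<close> with \<open>p' = p + \<epsilon>\<close> invertible.  The spectrum of \<open>p'\<^sup>-\<^sup>1\<close> is bounded
  below by some \<open>\<delta> > 0\<close>, so \<open>p'\<^sup>-\<^sup>1 + q\<close> is a positive element plus \<open>\<delta>\<close> and therefore invertible.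
\<close>

lemma invertible_one_plus_positive_mult:
  fixes p q :: "'a::unital_cstar_algebra"
  assumes p: "p \<in> positive_elements" and \<epsilon>: "0 < \<epsilon>" and q: "q \<in> positive_elements"
  shows "invertible_element (1 + (p + of_real \<epsilon>) * q)"
proof -
  let ?p = "p + of_real \<epsilon>"
  have inv_p: "invertible_element ?p" using p \<epsilon> by (simp add: positive_elements_iff)
  then obtain v where v: "?p * v = 1" "v * ?p = 1" unfolding invertible_element_def by blast
  have star_p: "star ?p = ?p" using p by (simp add: star_add positive_elements_star)
  have star_v: "star v = v" using star_p v by (rule selfadjoint_inverse)
  define \<delta> where "\<delta> = 1 / (norm ?p + 1)"
  have np: "0 < norm ?p + 1" using norm_ge_zero[of ?p] by linarith
  have \<delta>: "0 < \<delta>" "\<delta> * norm ?p < 1" using np by (simp_all add: \<delta>_def)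
  have "v - of_real \<delta> \<in> positive_elements"
  proof -
    have "invertible_element (v - of_real \<delta> + of_real r)" if r: "r > 0" for r
    proof -
      define \<mu> where "\<mu> = \<delta> - r"
      \<comment> \<open>The element in question is \<open>v - \<mu> = v (1 - \<mu> p')\<close>, where \<open>\<mu> < \<delta> < 1/\<parallel>p'\<parallel>\<close>: for
        positive \<open>\<mu>\<close> the geometric series inverts \<open>1 - \<mu> p'\<close>, for negative \<open>\<mu>\<close> positivity of \<open>p\<close>
        does.\<close>
      have "invertible_element (1 - \<mu> *\<^sub>R ?p)"
      proof (cases "0 < \<mu>")
        case True
        have "\<mu> * norm ?p \<le> \<delta> * norm ?p" using r by (intro mult_right_mono) (auto simp: \<mu>_def)
        with \<delta> True show ?thesis by (intro invertible_element_one_minus) simp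
      next
        case False
        show ?thesis
        proof (cases "\<mu> = 0")
          case True
          then show ?thesis by (auto simp: invertible_element_def)
        next
          case neq: False
          with False have \<mu>: "\<mu> < 0" by simp
          then have "0 < \<epsilon> + 1 / (- \<mu>)" using \<epsilon> by (intro add_pos_pos) auto
          then have "invertible_element (p + of_real (\<epsilon> + 1 / (- \<mu>)))"
            using p by (simp only: positive_elements_iff)
          then have "invertible_element ((- \<mu>) *\<^sub>R (p + of_real (\<epsilon> + 1 / (- \<mu>))))"
            using \<mu> by (simp only: invertible_element_scaleR_iff)
          also have "(- \<mu>) *\<^sub>R (p + of_real (\<epsilon> + 1 / (- \<mu>))) = 1 - \<mu> *\<^sub>R ?p"
            using \<mu> by (simp add: of_real_def algebra_simps flip: scaleR_left.add)
          finally show ?thesis .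
        qed
      qed
      moreover have "invertible_element v" using v by (rule_tac invertible_elementI)
      ultimately have "invertible_element (v * (1 - \<mu> *\<^sub>R ?p))"
        by (intro invertible_element_mult)
      also have "v * (1 - \<mu> *\<^sub>R ?p) = v - of_real \<delta> + of_real r"
        using v by (simp add: right_diff_distrib) (simp add: \<mu>_def of_real_def algebra_simps)
      finally show ?thesis .
    qed
    then show ?thesis by (simp add: positive_elements_iff star_diff star_v)
  qed
  then have "(v - of_real \<delta>) + q \<in> positive_elements" using q by (rule positive_elements_add)
  then have "invertible_element ((v - of_real \<delta>) + q + of_real \<delta>)"
    using \<delta> unfolding positive_elements_iff by blast
  then have "invertible_element (?p * (v + q))"
    using invertible_element_mult[OF inv_p, of "v + q"] by (simp add: algebra_simps)
  also have "?p * (v + q) = 1 + ?p * q" using v by (simp only: distrib_left)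
  finally show ?thesis .
qed

text \<open>
  For invertible \<open>p\<close>, swapping factors reduces the invertibility of \<open>r + b p b\<close> to that of
  \<open>1 + p b\<^sup>2/r\<close>.  The general case is the limit \<open>\<epsilon> \<rightarrow> 0\<close> of \<open>p + \<epsilon>\<close>, as the norm criterion for
  positivity is a closed condition once \<open>t\<close> is fixed.
\<close>

lemma positive_conjugation:
  fixes p b :: "'a::unital_cstar_algebra"
  assumes p: "p \<in> positive_elements" and b: "star b = b" and bb: "b * b \<in> positive_elements"
  shows "b * p * b \<in> positive_elements"
proof -
  have pos: "b * (p + of_real \<epsilon>) * b \<in> positive_elements" if \<epsilon>: "0 < \<epsilon>" for \<epsilon>
  proof -
    let ?p = "p + of_real \<epsilon>"
    have "invertible_element (b * ?p * b + of_real r)" if "r > 0" for r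
    proof -
      have "invertible_element (1 + ?p * (inverse r *\<^sub>R (b * b)))"
        using that by (intro invertible_one_plus_positive_mult p \<epsilon> positive_elements_scaleR bb) simp
      then have "invertible_element (1 + (inverse r *\<^sub>R (?p * b)) * b)"
        by (simp add: mult.assoc)
      then have "invertible_element (r *\<^sub>R (1 + b * (inverse r *\<^sub>R (?p * b))))"
        using that invertible_element_one_plus_swap[of "inverse r *\<^sub>R (?p * b)" b]
        by (simp add: invertible_element_scaleR_iff)
      also have "r *\<^sub>R (1 + b * (inverse r *\<^sub>R (?p * b))) = b * ?p * b + of_real r"
        using that by (simp add: scaleR_right_distrib mult.assoc of_real_def add.commute)
      finally show ?thesis .
    qed
    moreover have "star (b * ?p * b) = b * ?p * b"
      using p by (simp add: star_mult star_add b positive_elements_star mult.assoc)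
    ultimately show ?thesis by (simp add: positive_elements_iff)
  qed
  define t where "t = norm b * (norm p + 1) * norm b"
  have "norm (of_real t - b * p * b) \<le> t"
  proof (rule field_le_epsilon)
    fix e :: real assume e: "0 < e"
    define \<epsilon> where "\<epsilon> = min 1 (e / (norm b * norm b + 1))"
    have nb: "0 < norm b * norm b + 1" by (simp add: add_nonneg_pos)
    have \<epsilon>: "0 < \<epsilon>" "\<epsilon> \<le> 1" using e nb by (auto simp: \<epsilon>_def)
    have "norm (p + of_real \<epsilon>) \<le> norm p + 1"
      using \<epsilon> norm_triangle_ineq[of p "of_real \<epsilon>"] by simp
    then have "norm b * norm (p + of_real \<epsilon>) * norm b \<le> t"
      unfolding t_def by (intro mult_right_mono mult_left_mono) auto
    moreover have "norm (b * (p + of_real \<epsilon>) * b) \<le> norm b * norm (p + of_real \<epsilon>) * norm b"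
      by (metis norm_mult_ineq mult_right_mono norm_ge_zero order_trans)
    ultimately have 1: "norm (of_real t - b * (p + of_real \<epsilon>) * b) \<le> t"
      using norm_diff_le_if_positive[OF pos[OF \<epsilon>(1)]] by force
    have "norm (\<epsilon> *\<^sub>R (b * b)) \<le> \<epsilon> * (norm b * norm b)"
      using \<epsilon> norm_mult_ineq[of b b] by (simp add: mult_left_mono)
    also have "\<dots> \<le> e / (norm b * norm b + 1) * (norm b * norm b)"
      by (intro mult_right_mono) (auto simp: \<epsilon>_def)
    also have "\<dots> \<le> e" using e nb by (simp add: field_simps)
    finally have 2: "norm (\<epsilon> *\<^sub>R (b * b)) \<le> e" .
    have eq: "of_real t - b * p * b = (of_real t - b * (p + of_real \<epsilon>) * b) + \<epsilon> *\<^sub>R (b * b)"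
      by (simp add: of_real_def algebra_simps)
    show "norm (of_real t - b * p * b) \<le> t + e"
      unfolding eq using 1 2 by (intro norm_triangle_le add_mono)
  qed
  moreover have "star (b * p * b) = b * p * b"
    using p by (simp add: star_mult b positive_elements_star mult.assoc)
  ultimately show ?thesis by (intro positive_if_norm_diff_le)
qed

section \<open>The positive square root\<close>

text \<open>
  The relation gives \<open>(d + r)(2 b + r - d) = r (2 b + r)\<close> for all real \<open>r\<close>, and the right-hand side
  is invertible for \<open>r > 0\<close>.
\<close>

lemma positive_if_square_eq:
  fixes b d :: "'a::unital_cstar_algebra"
  assumes b: "b \<in> positive_elements" and d: "star d = d" and bd: "b * d = d * b"
    and sq: "d * d = 2 *\<^sub>R (b * d)"
  shows "d \<in> positive_elements"
proof -
  have "invertible_element (d + of_real r)" if r: "r > 0" for r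
  proof (rule invertible_element_commuting_factor)
    let ?e = "2 *\<^sub>R b + of_real r - d"
    have "(d + of_real r) * ?e = (2 * r) *\<^sub>R (b + of_real (r / 2))"
      using sq bd by (simp add: of_real_def algebra_simps)
    moreover have "invertible_element (b + of_real (r / 2))"
      using b r unfolding positive_elements_iff by (meson half_gt_zero)
    ultimately show "invertible_element ((d + of_real r) * ?e)"
      using r by (simp add: invertible_element_scaleR_iff)
    show "(d + of_real r) * ?e = ?e * (d + of_real r)"
      using bd by (simp add: of_real_def algebra_simps)
  qed
  with d show ?thesis by (simp add: positive_elements_iff)
qed

lemma positive_and_negative_imp_zero:
  assumes "d \<in> positive_elements" and "- d \<in> positive_elements"
  shows "d = 0"
proof (rule ccontr)
  assume "d \<noteq> 0"
  then have "invertible_element (d + of_real (norm d))" "invertible_element (- d + of_real (norm d))"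
    using assms by (simp_all add: positive_elements_iff)
  then show False
    using norm_attained_in_spectrum[of d] assms(1) by (simp add: positive_elements_star add.commute)
qed

text \<open>
  The difference \<open>d = b - c\<close> satisfies \<open>d\<^sup>2 = 2 b d\<close> and \<open>(- d)\<^sup>2 = 2 c (- d)\<close>, so \<open>d\<close> and \<open>- d\<close> are
  both positive.
\<close>

lemma positive_square_root_unique:
  assumes b: "b \<in> positive_elements" and c: "c \<in> positive_elements"
    and bc: "b * c = c * b" and sq: "b * b = c * c"
  shows "b = c"
proof -
  have "b - c \<in> positive_elements"
    using bc sq b c
    by (intro positive_if_square_eq[OF b]) (simp_all add: star_diff positive_elements_star algebra_simps scaleR_2)
  moreover have "c - b \<in> positive_elements"
    using bc sq b c
    by (intro positive_if_square_eq[OF c]) (simp_all add: star_diff positive_elements_star algebra_simps scaleR_2)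
  ultimately show ?thesis using positive_and_negative_imp_zero[of "b - c"] by simp
qed

lemma
  fixes a :: "'a::unital_cstar_algebra"
  assumes a: "a \<in> positive_elements" and t: "0 < t" "norm a \<le> t"
  shows iter_sqrt_positive: "iter_sqrt t a \<in> positive_elements"
    and iter_sqrt_unique: "b \<in> positive_elements \<Longrightarrow> b * b = a \<Longrightarrow> b = iter_sqrt t a"
proof -
  have le: "norm (of_real t - a) \<le> t" using a t(2) by (rule norm_diff_le_if_positive)
  show pos: "iter_sqrt t a \<in> positive_elements"
    using iter_sqrt_star[OF t(1) le] norm_iter_sqrt_le[OF t(1) le] a
    by (intro positive_if_norm_diff_le) (auto simp: positive_elements_star)
  assume b: "b \<in> positive_elements" and bb: "b * b = a"
  have "b * a = a * b" unfolding bb[symmetric] by (simp add: mult.assoc)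
  then have "b * iter_sqrt t a = iter_sqrt t a * b" by (rule iter_sqrt_commute[OF t(1) le])
  then show "b = iter_sqrt t a"
    by (rule positive_square_root_unique[OF b pos]) (simp only: bb iter_sqrt_square[OF t(1) le])
qed

lemma cstar_sqrt_eqI:
  assumes a: "a \<in> positive_elements" and b: "b \<in> positive_elements" and bb: "b * b = a"
  shows "cstar_sqrt a = b"
proof -
  have t: "0 < norm a + 1" "norm a \<le> norm a + 1" using norm_ge_zero[of a] by linarith+
  show ?thesis
    unfolding cstar_sqrt_def
  proof (rule the_equality)
    show "c = b" if "c \<in> positive_elements \<and> c * c = a" for c
      using that b bb iter_sqrt_unique[OF a t] by metis
  qed (use b bb in blast)
qed

lemma cstar_sqrt_eq_iter_sqrt:
  assumes a: "a \<in> positive_elements" and t: "0 < t" "norm a \<le> t"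
  shows "cstar_sqrt a = iter_sqrt t a"
  using a iter_sqrt_positive[OF a t] iter_sqrt_square[OF t(1) norm_diff_le_if_positive[OF a t(2)]]
  by (rule cstar_sqrt_eqI)

lemma
  assumes a: "a \<in> positive_elements"
  shows cstar_sqrt_positive: "cstar_sqrt a \<in> positive_elements"
    and cstar_sqrt_square: "cstar_sqrt a * cstar_sqrt a = a"
proof -
  have t: "0 < norm a + 1" "norm a \<le> norm a + 1" using norm_ge_zero[of a] by linarith+
  show "cstar_sqrt a \<in> positive_elements" "cstar_sqrt a * cstar_sqrt a = a"
    using cstar_sqrt_eq_iter_sqrt[OF a t] iter_sqrt_positive[OF a t]
      iter_sqrt_square[OF t(1) norm_diff_le_if_positive[OF a t(2)]] by simp_all
qed

text \<open>
  On each ball of radius \<open>t\<close> the square root coincides with \<^term>\<open>iter_sqrt t\<close>, which is continuous.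
\<close>

lemma continuous_on_cstar_sqrt:
  "continuous_on positive_elements (cstar_sqrt :: 'a::unital_cstar_algebra \<Rightarrow> 'a)"
  unfolding continuous_on_eq_continuous_within
proof
  fix x :: 'a assume x: "x \<in> positive_elements"
  define t where "t = norm x + 1"
  have t: "0 < t" "norm x < t" unfolding t_def using norm_ge_zero[of x] by linarith+
  let ?P = "positive_elements \<inter> ball 0 t"
  have "continuous_on ?P (iter_sqrt t)"
    by (rule continuous_on_subset[OF continuous_on_iter_sqrt[OF t(1)]])
      (auto intro!: norm_diff_le_if_positive)
  moreover have "cstar_sqrt a = iter_sqrt t a" if "a \<in> ?P" for a
    using that t by (intro cstar_sqrt_eq_iter_sqrt) auto
  ultimately have "continuous_on ?P cstar_sqrt"
    using continuous_on_cong[of ?P ?P cstar_sqrt "iter_sqrt t"] by blast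
  then have "continuous (at x within ?P) cstar_sqrt"
    using x t unfolding continuous_on_eq_continuous_within by auto
  moreover have "at x within positive_elements = at x within ?P"
    by (rule at_within_nhd[of x "ball 0 t"]) (use t in auto)
  ultimately show "continuous (at x within positive_elements) cstar_sqrt" by simp
qed

section \<open>Positive functionals and the Bures distance\<close>

text \<open>
  The element \<open>\<parallel>h\<parallel> - h\<close> is positive.
\<close>

lemma positive_linear_functional_le_norm:
  fixes \<tau> :: "'a::unital_cstar_algebra \<Rightarrow> complex"
  assumes \<tau>: "positive_linear_functional \<tau>" and one: "\<tau> 1 = 1" and h: "star h = h"
  shows "Re (\<tau> h) \<le> norm h"
proof -
  have add: "\<tau> (a + b) = \<tau> a + \<tau> b" and scale: "\<tau> (c *\<^sub>C a) = c * \<tau> a" for a b c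
    using \<tau> by (auto simp: positive_linear_functional_def)
  have "of_real (norm h) - h \<in> positive_elements"
    using h by (intro positive_if_norm_diff_le[of _ "norm h"]) (simp_all add: star_diff)
  then have "0 \<le> Re (\<tau> (of_real (norm h) - h))"
    using \<tau> by (auto simp: positive_linear_functional_def complex_nonneg_Reals_iff)
  moreover have "\<tau> (of_real (norm h)) = of_real (norm h)"
    using scale[of "of_real (norm h)" 1] by (simp add: scaleC_of_real_one one)
  then have "\<tau> (of_real (norm h) - h) + \<tau> h = of_real (norm h)"
    using add[of "of_real (norm h) - h" h] by simp
  then have "Re (\<tau> (of_real (norm h) - h)) + Re (\<tau> h) = norm h"
    by (metis Re_complex_of_real plus_complex.simps(1))
  ultimately show ?thesis by linarith
qed

lemma continuous_on_Re_functional: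
  fixes \<tau> :: "'a::unital_cstar_algebra \<Rightarrow> complex"
  assumes \<tau>: "positive_linear_functional \<tau>" and one: "\<tau> 1 = 1"
  shows "continuous_on {a. star a = a} (\<lambda>a. Re (\<tau> a))"
proof (rule continuous_onI)
  fix a b :: 'a and e :: real
  assume e: "0 < e" and "a \<in> {a. star a = a}"
  then have a: "star a = a" by simp
  have add: "\<tau> (a + b) = \<tau> a + \<tau> b" for a b
    using \<tau> by (auto simp: positive_linear_functional_def)
  have lip: "Re (\<tau> c) - Re (\<tau> d) \<le> norm (c - d)" if "star c = c" "star d = d" for c d
    using positive_linear_functional_le_norm[OF \<tau> one, of "c - d"] add[of "c - d" d] that
    by (simp add: star_diff)
  show "\<exists>d>0. \<forall>b\<in>{a. star a = a}. dist b a < d \<longrightarrow> dist (Re (\<tau> b)) (Re (\<tau> a)) \<le> e"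
  proof (intro exI conjI ballI impI)
    fix b assume "b \<in> {a. star a = a}" and "dist b a < e"
    then show "dist (Re (\<tau> b)) (Re (\<tau> a)) \<le> e"
      using lip[of a b] lip[of b a] a by (simp add: dist_norm norm_minus_commute abs_le_iff)
  qed (fact e)
qed

text \<open>
  The element is \<open>\<surd>y x \<surd>y\<close>.  Its positivity is what gives the definite description behind
  \<open>\<bar>\<surd>x\<surd>y\<bar>\<close> its meaning.
\<close>

lemma star_mult_self_positive_sqrt_mult:
  assumes x: "x \<in> positive_elements" and y: "y \<in> positive_elements"
  shows "star (cstar_sqrt x * cstar_sqrt y) * (cstar_sqrt x * cstar_sqrt y) \<in> positive_elements"
proof -
  let ?x = "cstar_sqrt x" and ?y = "cstar_sqrt y"
  have star: "star ?x = ?x" "star ?y = ?y"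
    using cstar_sqrt_positive x y positive_elements_star by blast+
  have "star (?x * ?y) * (?x * ?y) = ?y * (?x * ?x) * ?y"
    by (simp only: star_mult star mult.assoc)
  then show ?thesis
    using positive_conjugation[OF x star(2)] cstar_sqrt_square x y by metis
qed

theorem corollary2p4:
  fixes \<tau> :: "'a::unital_cstar_algebra \<Rightarrow> complex"
  assumes "faithful_tracial_state \<tau>"
  shows "finer_topology
           (metric_topology (density_space \<tau>) cstar_dist)
           (metric_topology (density_space \<tau>) (bures_dist \<tau>))"
proof -
  have \<tau>: "positive_linear_functional \<tau>" and one: "\<tau> 1 = 1"
    using assms by (auto simp: faithful_tracial_state_def faithful_trace_def)
  let ?P = "positive_elements :: 'a set"
  have near: "\<exists>\<delta>>0. \<forall>y\<in>density_space \<tau>. cstar_dist x y < \<delta> \<longrightarrow> bures_dist \<tau> x y < r"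
    if x: "x \<in> density_space \<tau>" and r: "0 < r" for x r
  proof -
    have xP: "x \<in> ?P" and \<tau>x: "\<tau> x = 1" using x by (auto simp: density_space_def)
    have "continuous_on ?P (\<lambda>y. star (cstar_sqrt x * cstar_sqrt y) * (cstar_sqrt x * cstar_sqrt y))"
      by (intro continuous_intros continuous_on_cstar_sqrt bounded_linear.continuous_on[OF bounded_linear_star])
    then have "continuous_on ?P (\<lambda>y. cstar_abs (cstar_sqrt x * cstar_sqrt y))"
      unfolding cstar_abs_def
      by (rule continuous_on_compose2[OF continuous_on_cstar_sqrt])
        (use star_mult_self_positive_sqrt_mult[OF xP] in blast)
    then have "continuous_on ?P (\<lambda>y. Re (\<tau> (cstar_abs (cstar_sqrt x * cstar_sqrt y))))"
      by (rule continuous_on_compose2[OF continuous_on_Re_functional[OF \<tau> one]])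
        (use star_mult_self_positive_sqrt_mult[OF xP] in
          \<open>auto simp: cstar_abs_def intro!: positive_elements_star cstar_sqrt_positive\<close>)
    then have cont: "continuous_on ?P (bures_dist \<tau> x)"
      unfolding bures_dist_def[abs_def]
      by (intro continuous_on_real_sqrt continuous_on_diff continuous_on_const)
    have "cstar_abs (cstar_sqrt x * cstar_sqrt x) = x"
      unfolding cstar_abs_def
    proof (rule cstar_sqrt_eqI)
      show "star (cstar_sqrt x * cstar_sqrt x) * (cstar_sqrt x * cstar_sqrt x) \<in> ?P"
        by (rule star_mult_self_positive_sqrt_mult[OF xP xP])
      show "x * x = star (cstar_sqrt x * cstar_sqrt x) * (cstar_sqrt x * cstar_sqrt x)"
        using xP by (simp add: cstar_sqrt_square positive_elements_star)
    qed (fact xP)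
    then have "bures_dist \<tau> x x = 0" by (simp add: bures_dist_def \<tau>x)
    with cont xP r obtain \<delta> where "\<delta> > 0"
      and \<delta>: "\<And>y. y \<in> ?P \<Longrightarrow> dist y x < \<delta> \<Longrightarrow> dist (bures_dist \<tau> x y) 0 < r"
      unfolding continuous_on_iff by metis
    have "bures_dist \<tau> x y < r" if "y \<in> density_space \<tau>" "cstar_dist x y < \<delta>" for y
      using \<delta>[of y] that by (simp add: density_space_def cstar_dist_def dist_norm norm_minus_commute)
    with \<open>\<delta> > 0\<close> show ?thesis by blast
  qed
  show ?thesis
    unfolding finer_topology_def openin_metric_topology
  proof (intro allI impI conjI ballI)
    fix U x
    assume U: "U \<subseteq> density_space \<tau> \<and> (\<forall>x\<in>U. \<exists>r>0. {y \<in> density_space \<tau>. bures_dist \<tau> x y < r} \<subseteq> U)"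
    then show "U \<subseteq> density_space \<tau>" by blast
    assume "x \<in> U"
    with U obtain r where "0 < r" and r: "{y \<in> density_space \<tau>. bures_dist \<tau> x y < r} \<subseteq> U"
      and "x \<in> density_space \<tau>" by blast
    with near obtain \<delta> where "\<delta> > 0"
      and "\<forall>y\<in>density_space \<tau>. cstar_dist x y < \<delta> \<longrightarrow> bures_dist \<tau> x y < r" by blast
    with r have "{y \<in> density_space \<tau>. cstar_dist x y < \<delta>} \<subseteq> U" by blast
    with \<open>\<delta> > 0\<close> show "\<exists>r>0. {y \<in> density_space \<tau>. cstar_dist x y < r} \<subseteq> U" by blast
  qed
qed

end
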